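(* Let $\overline{h}>0$, $0<\lambda_2\le\lambda_N$ and $0<\mu_1<\mu_2$, and let $$T:=\begin{bmatrix}\mu_2-\mu_1&-(\mu_2+\mu_1)\\0&2\end{bmatrix}.$$ Suppose $k_1,k_2\in\mathbb{R}$ satisfy $$\frac{2(\mu_2-\mu_1)}{\overline{h}\lambda_N(\mu_1+\mu_2+\overline{h})}>k_1>0,$$ $$\min\left\{\frac{2}{\overline{h}\lambda_N},\ \frac{4}{\lambda_N(2\mu_1+\overline{h})}\right\}>k_2>\frac{4}{\lambda_2(\mu_1+\mu_2)},$$ $$\frac{4}{\lambda_N(\mu_1+\mu_2+\overline{h})}>k_2-k_1>0 .$$ Let $K:=\begin{bmatrix}k_1&k_2\end{bmatrix}T^{-1}$. Then, for every admissible sampling sequence $\{t_k\}_{k\in\mathbb{N}}$ with intervals in $(0,\overline{h})$ and every sequence of balanced weighted graphs $G_k$ on $N$ nodes ($k\in\mathbb{N}$), each having a spanning tree and such that all eigenvalues of its Laplacian other than the simple eigenvalue $0$ lie in $[\lambda_2,\lambda_N]$, the control law $$u_i(t)=K\sum_{j=1}^N w_{ij}^{(k)}\left(x_j(t_k)-x_i(t_k)\right),\qquad t\in[t_k,t_{k+1}),\ i=1,\dots,N,$$ where $(w_{ij}^{(k)})$ is the weighted adjacency matrix of $G_k$, solves the consensus problem asymptotically for the $N$ double integrator agents $\dot{x}_i(t)=Ax_i(t)+Bu_i(t)$, $i=1,\dots,N$, with $A=\begin{bmatrix}0&1\\0&0\end{bmatrix}$ and $B=\begin{bmatrix}0\\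1\end{bmatrix}$.
   Context: $\mathbb{N}$ denotes the nonnegative integers. Graphs: a graph $G=(V,E)$ with $V=\{v_1,\dots,v_N\}$, $E\subseteq V\times V$, is simple (no self-loops, no multiple edges). An edge $(v_i,v_j)\in E$ denotes information flow from agent $j$ to agent $i$. The weighted adjacency matrix $W=(w_{ij})\in\mathbb{R}^{N\times N}$ satisfies $w_{ij}>0$ if $(v_i,v_j)\in E$ and $w_{ij}=0$ otherwise. The graph is called balanced if $W=W^T$. The in-degree is $d_i=\sum_{j}w_{ij}$ and the Laplacian is $L=D-W$, $D=\operatorname{diag}\{d_i\}$. The graph has a spanning tree if a subset of its edges forms a directed tree on all of $V$ (for balanced graphs: the underlying undirected graph is connected); in that case $0$ is a simple eigenvalue of $L$. Sampling: an admissible sampling sequence is $0=t_0<t_1<\dots$ with $\lim_{k\to\infty}t_k=\infty$ and $h_k:=t_{k+1}-t_k\in(0,\overline{h})$ for all $k\in\mathbb{N}$. Consensus: $x_i(t)\in\mathbb{R}^2$ is the state and $u_i(t)\in\mathbb{R}$ the control input of agent $i$. The control inputs solve the consensus problem asymptotically if for all initial states $\lim_{t\to\infty}(x_i(t)-x_j(t))=0$ for all $i,j=1,\dots,N$. *)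

theory Defs
  imports "HOL-Analysis.Analysis"
begin

section \<open>Weighted graphs and their Laplacians\<close>

text \<open>
  The vertex set is the whole finite type \<open>'n\<close>, so \<open>N = CARD('n)\<close>. A pair \<open>(i, j)\<close> in the edge
  relation denotes information flow from \<open>j\<close> to \<open>i\<close>; thus \<open>j\<close> is the parent of \<open>i\<close>. Edges form a
  relation, so there are no multiple edges and simplicity amounts to the absence of self-loops.
\<close>

definition weighted_graph :: "('n::finite \<times> 'n) set \<Rightarrow> real^'n^'n \<Rightarrow> bool" where
  "weighted_graph E W \<longleftrightarrow>
     irrefl E \<and>
     (\<forall>i j. ((i, j) \<in> E \<longrightarrow> W $ i $ j > 0) \<and> ((i, j) \<notin> E \<longrightarrow> W $ i $ j = 0))"

definition balanced :: "real^'n^'n::finite \<Rightarrow> bool" where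
  "balanced W \<longleftrightarrow> W = transpose W"

text \<open>A directed tree spanning the vertex type: the root has no parent, every other vertex has
  exactly one parent, and every vertex is reached by a directed path from the root.\<close>

definition directed_tree :: "('n::finite \<times> 'n) set \<Rightarrow> bool" where
  "directed_tree F \<longleftrightarrow>
     (\<exists>r. (\<forall>j. (r, j) \<notin> F) \<and>
          (\<forall>i. i \<noteq> r \<longrightarrow> (\<exists>!j. (i, j) \<in> F)) \<and>
          (\<forall>i. (i, r) \<in> F\<^sup>*))"

definition has_spanning_tree :: "('n::finite \<times> 'n) set \<Rightarrow> bool" where
  "has_spanning_tree E \<longleftrightarrow> (\<exists>F\<subseteq>E. directed_tree F)"

definition in_degree :: "real^'n^'n::finite \<Rightarrow> 'n \<Rightarrow> real" where
  "in_degree W i = (\<Sum>j\<in>UNIV. W $ i $ j)"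

definition laplacian :: "real^'n^'n::finite \<Rightarrow> real^'n^'n" where
  "laplacian W = (\<chi> i j. if i = j then in_degree W i else 0) - W"

text \<open>Only applied to symmetric matrices, all of whose complex eigenvalues are real.\<close>

definition eigenvalue :: "real^'n^'n::finite \<Rightarrow> real \<Rightarrow> bool" where
  "eigenvalue M c \<longleftrightarrow> (\<exists>v. v \<noteq> 0 \<and> M *v v = c *\<^sub>R v)"

section \<open>Sampled-data control of double integrator agents\<close>

definition admissible_sampling :: "real \<Rightarrow> (nat \<Rightarrow> real) \<Rightarrow> bool" where
  "admissible_sampling hbar t \<longleftrightarrow>
     t 0 = 0 \<and> filterlim t at_top sequentially \<and>
     (\<forall>k. t (Suc k) - t k \<in> {0<..<hbar})"

definition A_mat :: "real^2^2" where
  "A_mat = vector [vector [0, 1], vector [0, 0]]"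

definition B_vec :: "real^2" where
  "B_vec = vector [0, 1]"

text \<open>
  The input may jump at the sampling instants. A state trajectory on \<open>[0, \<infinity>)\<close> is continuous and
  satisfies the differential equation on every \<open>[t k, t (k + 1))\<close>, where the derivative at \<open>t k\<close>
  is the right-hand one.
\<close>

definition agent_trajectory ::
    "(nat \<Rightarrow> real) \<Rightarrow> (real \<Rightarrow> real) \<Rightarrow> (real \<Rightarrow> real^2) \<Rightarrow> bool" where
  "agent_trajectory t u x \<longleftrightarrow>
     continuous_on {0..} x \<and>
     (\<forall>k. \<forall>s\<in>{t k..<t (Suc k)}.
        (x has_vector_derivative (A_mat *v x s + u s *\<^sub>R B_vec)) (at s within {t k..<t (Suc k)}))"

text \<open>The row vector \<open>K\<close> is represented by a vector, its product with a column by \<open>\<bullet>\<close>.\<close>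

definition sampled_control_law ::
    "(nat \<Rightarrow> real) \<Rightarrow> real^2 \<Rightarrow> (nat \<Rightarrow> real^'n^'n::finite) \<Rightarrow>
     ('n \<Rightarrow> real \<Rightarrow> real^2) \<Rightarrow> ('n \<Rightarrow> real \<Rightarrow> real) \<Rightarrow> bool" where
  "sampled_control_law t K W x u \<longleftrightarrow>
     (\<forall>k. \<forall>s\<in>{t k..<t (Suc k)}. \<forall>i.
        u i s = K \<bullet> (\<Sum>j\<in>UNIV. W k $ i $ j *\<^sub>R (x j (t k) - x i (t k))))"

text \<open>A control law is a relation between the state trajectories and the inputs of all agents.\<close>

definition solves_consensus ::
    "(nat \<Rightarrow> real) \<Rightarrow> (('n::finite \<Rightarrow> real \<Rightarrow> real^2) \<Rightarrow> ('n \<Rightarrow> real \<Rightarrow> real) \<Rightarrow> bool) \<Rightarrow> bool" where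
  "solves_consensus t law \<longleftrightarrow>
     (\<forall>x0 x u. (\<forall>i. x i 0 = x0 i) \<and> (\<forall>i. agent_trajectory t (u i) (x i)) \<and> law x u \<longrightarrow>
        (\<forall>i j. ((\<lambda>s. x i s - x j s) \<longlongrightarrow> 0) at_top))"

end

theory Submission
  imports Defs
begin

text \<open>
  In the coordinates \<open>z\<close> given by \<open>x = T z\<close> the feedback is \<open>k1 z1 + k2 z2\<close>, and after time \<open>h\<close> the component
  of the state along an eigenvector of the Laplacian with eigenvalue \<open>l\<close> has been multiplied by a
  two by two matrix with entries depending on \<open>h\<close> and \<open>l\<close>. The conditions on \<open>k1\<close> and \<open>k2\<close> give this
  matrix the sign pattern of nonnegative diagonal and nonpositive off-diagonal entries, and they make
  both its absolute row sums and its absolute column sums at most \<open>1 - c h\<close>, with one \<open>c > 0\<close> for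
  all admissible \<open>h\<close> and \<open>l\<close> (\<open>mode_contraction\<close>). By the Schur test (\<open>schur_test_2\<close>) the
  matrix then contracts the Euclidean norm by the factor \<open>1 - c h\<close>.

  It is essential that the contracted norm is the Euclidean one. The Laplacians of successive graphs
  need not commute, so there is no common eigenbasis; row sums alone would only give a contraction in
  the maximum norm of each mode, and that estimate does not survive a change of eigenbasis. The
  Euclidean norm of all deviations from the average is the same in every orthonormal
  eigenbasis (\<open>symmetric_orthonormal_eigenbasis\<close>, \<open>parseval_orthonormal\<close>), hence it is a common
  Lyapunov function for all graphs (\<open>disagreement_step\<close>). Its decay factor over time \<open>h\<close> is at most
  \<open>exp (- c h)\<close>, so it decays exponentially in continuous time
  (\<open>admissible_sampling_exponential_decay\<close>), whatever the sampling sequence is.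
\<close>

section \<open>Spectral theorem for symmetric linear maps\<close>

text \<open>A maximiser of the Rayleigh quotient on the unit sphere of the subspace is an eigenvector: the
  first variation of the quotient vanishes in the direction of the residual, which is thus zero.\<close>

lemma symmetric_eigenvector_exists:
  fixes f :: "'a::euclidean_space \<Rightarrow> 'a"
  assumes "linear f" and sym: "\<And>x y. f x \<bullet> y = x \<bullet> f y"
    and S: "subspace S" "f ` S \<subseteq> S" "S \<noteq> {0}"
  obtains e c where "e \<in> S" "norm e = 1" "f e = c *\<^sub>R e"
proof -
  interpret f: linear f by fact
  have "S \<inter> sphere 0 1 \<noteq> {}"
  proof -
    obtain x where x: "x \<in> S" "x \<noteq> 0"
      using S subspace_0 by blast
    then have "x /\<^sub>R norm x \<in> S \<inter> sphere 0 1"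
      using S(1) by (simp add: subspace_scale)
    then show ?thesis by blast
  qed
  moreover have "compact (S \<inter> sphere 0 1)"
    using closed_subspace[OF S(1)] by (simp add: closed_Int_compact)
  moreover have "continuous_on (S \<inter> sphere 0 1) (\<lambda>x. x \<bullet> f x)"
    by (intro continuous_intros linear_continuous_on linear_linear[THEN iffD2] assms)
  ultimately obtain e where "e \<in> S \<inter> sphere 0 1" "\<forall>x\<in>S \<inter> sphere 0 1. x \<bullet> f x \<le> e \<bullet> f e"
    using continuous_attains_sup[of "S \<inter> sphere 0 1" "\<lambda>x. x \<bullet> f x"] by blast
  then have e: "e \<in> S" "norm e = 1"
    and max: "\<And>x. x \<in> S \<Longrightarrow> norm x = 1 \<Longrightarrow> x \<bullet> f x \<le> e \<bullet> f e"
    by auto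
  define m where "m = e \<bullet> f e"
  have rayleigh: "x \<bullet> f x \<le> m * (x \<bullet> x)" if "x \<in> S" for x
  proof (cases "x = 0")
    case False
    have "(x /\<^sub>R norm x) \<bullet> f (x /\<^sub>R norm x) \<le> m"
      using max[of "x /\<^sub>R norm x"] that False S(1) by (simp add: m_def subspace_scale)
    then have "(x \<bullet> f x) / (norm x)\<^sup>2 \<le> m"
      by (simp add: f.scale field_simps power2_eq_square)
    then show ?thesis
      using False by (simp add: field_simps dot_square_norm)
  qed (simp add: f.zero)
  define y where "y = f e - m *\<^sub>R e"
  have yS: "y \<in> S"
    unfolding y_def using S e(1) by (intro subspace_diff subspace_scale) auto
  define d where "d = y \<bullet> f y - m * (y \<bullet> y)"
  have variation: "2 * s * (y \<bullet> y) + s\<^sup>2 * d \<le> 0" for s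
  proof -
    have "e + s *\<^sub>R y \<in> S"
      using S(1) e(1) yS by (intro subspace_add subspace_scale)
    note rayleigh[OF this]
    moreover have "(e + s *\<^sub>R y) \<bullet> f (e + s *\<^sub>R y)
        = e \<bullet> f e + 2 * s * (y \<bullet> f e) + s\<^sup>2 * (y \<bullet> f y)"
    proof -
      have "e \<bullet> f y = y \<bullet> f e" by (metis sym inner_commute)
      then show ?thesis
        by (simp add: f.add f.scale inner_add_left inner_add_right power2_eq_square)
          (simp add: algebra_simps)
    qed
    moreover have "(e + s *\<^sub>R y) \<bullet> (e + s *\<^sub>R y) = e \<bullet> e + 2 * s * (y \<bullet> e) + s\<^sup>2 * (y \<bullet> y)"
    proof -
      have "e \<bullet> y = y \<bullet> e" by (rule inner_commute)
      then show ?thesis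
        by (simp add: inner_add_left inner_add_right power2_eq_square) (simp add: algebra_simps)
    qed
    moreover have "y \<bullet> y = y \<bullet> f e - m * (y \<bullet> e)"
    proof -
      have "y \<bullet> (f e - m *\<^sub>R e) = y \<bullet> f e - m * (y \<bullet> e)"
        by (simp only: inner_diff_right inner_scaleR_right)
      then show ?thesis by (simp only: flip: y_def)
    qed
    moreover from this have "2 * s * (y \<bullet> y) + s\<^sup>2 * d = (m + 2 * s * (y \<bullet> f e) + s\<^sup>2 * (y \<bullet> f y))
        - m * (1 + 2 * s * (y \<bullet> e) + s\<^sup>2 * (y \<bullet> y))"
      unfolding d_def by algebra
    moreover have "e \<bullet> e = 1" using e(2) by (simp add: dot_square_norm)
    ultimately show ?thesis by (simp add: m_def)
  qed
  have "y = 0"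
  proof (rule ccontr)
    assume "y \<noteq> 0"
    then have pos: "y \<bullet> y > 0" by simp
    \<comment> \<open>A step small enough for the first-order term to dominate the second-order one.\<close>
    define s where "s = (y \<bullet> y) / (\<bar>d\<bar> + 1)"
    have s: "s > 0" "s * (\<bar>d\<bar> + 1) = y \<bullet> y" using pos by (auto simp: s_def)
    have "s * \<bar>d\<bar> \<le> y \<bullet> y" using s by (simp add: algebra_simps)
    moreover have "s * (- \<bar>d\<bar>) \<le> s * d" using s(1) by (intro mult_left_mono) auto
    ultimately have "2 * (y \<bullet> y) + s * d > 0" using pos by linarith
    then have "s * (2 * (y \<bullet> y) + s * d) > 0" using s(1) by simp
    with variation[of s] show False by (simp add: algebra_simps power2_eq_square)
  qed
  then have "f e = m *\<^sub>R e" by (simp add: y_def)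
  with e show thesis by (rule that)
qed

text \<open>A symmetric map that preserves a subspace also preserves the orthogonal complement, within it,
  of an eigenvector; induction on the dimension then splits off eigenvectors one at a time.\<close>

theorem symmetric_orthonormal_eigenbasis:
  fixes f :: "'a::euclidean_space \<Rightarrow> 'a"
  assumes f: "linear f" and sym: "\<And>x y. f x \<bullet> y = x \<bullet> f y"
    and "subspace S" "f ` S \<subseteq> S"
  shows "\<exists>B. finite B \<and> B \<subseteq> S \<and> pairwise orthogonal B \<and> (\<forall>e\<in>B. norm e = 1)
    \<and> S \<subseteq> span B \<and> (\<forall>e\<in>B. \<exists>c. f e = c *\<^sub>R e)"
  using assms(3,4)
proof (induction "dim S" arbitrary: S rule: less_induct)
  case less
  note S = less.prems
  show ?case
  proof (cases "S = {0}")
    case True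
    then show ?thesis by (intro exI[of _ "{}"]) auto
  next
    case False
    obtain e c where e: "e \<in> S" "norm e = 1" "f e = c *\<^sub>R e"
      using symmetric_eigenvector_exists[OF f sym S False] by blast
    have ee: "e \<bullet> e = 1" using e(2) by (simp add: dot_square_norm)
    let ?S = "S \<inter> {x. e \<bullet> x = 0}"
    have sub: "subspace ?S"
      by (intro subspace_inter S(1) subspace_hyperplane)
    have inv: "f ` ?S \<subseteq> ?S"
      using S(2) e(3) by (auto simp flip: sym)
    have "e \<notin> ?S" using ee by simp
    then have "?S \<subset> S" using e(1) by blast
    then have "dim ?S < dim S"
      using sub S(1) by (intro dim_psubset) (simp only: span_eq_iff[THEN iffD2])
    from less.hyps[OF this sub inv] obtain B where B: "finite B" "B \<subseteq> ?S"
        "pairwise orthogonal B" "\<forall>e\<in>B. norm e = 1" "?S \<subseteq> span B" "\<forall>e\<in>B. \<exists>c. f e = c *\<^sub>R e"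
      by blast
    have "S \<subseteq> span (insert e B)"
    proof
      fix x assume "x \<in> S"
      then have "x - (e \<bullet> x) *\<^sub>R e \<in> ?S"
        using S(1) e(1) ee by (auto simp: inner_diff_right subspace_diff subspace_scale)
      then show "x \<in> span (insert e B)"
        using B(5) by (auto simp: span_breakdown_eq)
    qed
    moreover have "pairwise orthogonal (insert e B)"
      using B(2,3) by (auto simp: pairwise_insert orthogonal_def inner_commute)
    ultimately show ?thesis
      using B e S by (intro exI[of _ "insert e B"]) auto
  qed
qed

lemma parseval_orthonormal:
  assumes B: "pairwise orthogonal B" "\<And>e. e \<in> B \<Longrightarrow> norm e = 1" "finite B"
    and x: "x \<in> span B"
  shows "(norm x)\<^sup>2 = (\<Sum>e\<in>B. (x \<bullet> e)\<^sup>2)"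
proof -
  have "x \<bullet> x = x \<bullet> (\<Sum>e\<in>B. (x \<bullet> e) *\<^sub>R e)"
    using orthonormal_basis_expand[OF B(1,2) x B(3)] by simp
  then show ?thesis
    by (simp add: inner_sum_right power2_norm_eq_inner) (simp add: power2_eq_square)
qed

section \<open>Contraction of a single mode\<close>

text \<open>The Schur test: bounds on both absolute row sums and absolute column sums bound the Euclidean
  operator norm. The row sums enter through the Cauchy-Schwarz inequality with weights given by the
  entries, and the column sums when the weighted squares are added up.\<close>

lemma schur_test_2:
  fixes m11 m12 m21 m22 r x y :: real
  assumes "\<bar>m11\<bar> + \<bar>m12\<bar> \<le> r" "\<bar>m21\<bar> + \<bar>m22\<bar> \<le> r" "\<bar>m11\<bar> + \<bar>m21\<bar> \<le> r" "\<bar>m12\<bar> + \<bar>m22\<bar> \<le> r"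
  shows "(m11 * x + m12 * y)\<^sup>2 + (m21 * x + m22 * y)\<^sup>2 \<le> r\<^sup>2 * (x\<^sup>2 + y\<^sup>2)"
proof -
  have cs: "(p * x + q * y)\<^sup>2 \<le> r * (\<bar>p\<bar> * x\<^sup>2 + \<bar>q\<bar> * y\<^sup>2)" if "\<bar>p\<bar> + \<bar>q\<bar> \<le> r" for p q
  proof -
    have "(\<bar>p\<bar> + \<bar>q\<bar>) * (\<bar>p\<bar> * x\<^sup>2 + \<bar>q\<bar> * y\<^sup>2) - (p * x + q * y)\<^sup>2
        = \<bar>p\<bar> * \<bar>q\<bar> * (x\<^sup>2 + y\<^sup>2) - 2 * (p * q) * (x * y)"
      by (simp add: power2_eq_square algebra_simps)
    also have "\<dots> = \<bar>p * q\<bar> * (x\<^sup>2 + y\<^sup>2) - 2 * (p * q) * (x * y)"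
      by (simp add: abs_mult)
    also have "\<dots> \<ge> 0"
    proof -
      have "2 * (p * q) * (x * y) \<le> \<bar>p * q\<bar> * (2 * \<bar>x * y\<bar>)"
        by (metis abs_ge_self abs_mult abs_numeral mult.assoc mult.left_commute)
      also have "\<dots> \<le> \<bar>p * q\<bar> * (x\<^sup>2 + y\<^sup>2)"
        using sum_squares_bound[of "\<bar>x\<bar>" "\<bar>y\<bar>"] by (intro mult_left_mono) (auto simp: abs_mult)
      finally show ?thesis by simp
    qed
    finally have "(p * x + q * y)\<^sup>2 \<le> (\<bar>p\<bar> + \<bar>q\<bar>) * (\<bar>p\<bar> * x\<^sup>2 + \<bar>q\<bar> * y\<^sup>2)" by simp
    also have "\<dots> \<le> r * (\<bar>p\<bar> * x\<^sup>2 + \<bar>q\<bar> * y\<^sup>2)"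
      using that by (intro mult_right_mono) auto
    finally show ?thesis .
  qed
  have r: "r \<ge> 0" using assms(1) by linarith
  have "(m11 * x + m12 * y)\<^sup>2 + (m21 * x + m22 * y)\<^sup>2
      \<le> r * ((\<bar>m11\<bar> + \<bar>m21\<bar>) * x\<^sup>2 + (\<bar>m12\<bar> + \<bar>m22\<bar>) * y\<^sup>2)"
    using cs[OF assms(1)] cs[OF assms(2)] by (simp add: algebra_simps)
  also have "\<dots> \<le> r * (r * x\<^sup>2 + r * y\<^sup>2)"
    using assms r by (intro mult_left_mono add_mono mult_right_mono) auto
  finally show ?thesis by (simp add: power2_eq_square algebra_simps)
qed

text \<open>
  The conditions on the gains are those under which the Schur test applies uniformly. Upper bounds on
  \<open>k1\<close> and \<open>k2\<close> make the diagonal entries of the planar step matrix nonnegative; the lower bound on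
  \<open>k2\<close> makes the upper right entry nonpositive, and the lower left one is nonpositive because
  \<open>k1 > 0\<close>. With these signs every absolute row or column sum is affine in the gains: the rows are
  controlled by \<open>0 < k2 - k1 < 4 / (lamN (mu1 + mu2 + hbar))\<close>, the first column by \<open>k1 > 0\<close>, and the
  second column by \<open>k2 < 4 / (lamN (2 mu1 + hbar))\<close>. Each sum falls short of one by at least a fixed
  multiple of the interval length \<open>h\<close>, because all these inequalities are strict and involve only
  the extreme values of \<open>h\<close> and of the eigenvalue \<open>l\<close>.
\<close>

lemma mode_contraction:
  fixes hbar lam2 lamN mu1 mu2 k1 k2 :: real
  assumes "hbar > 0" and "0 < lam2" and "lam2 \<le> lamN" and "0 < mu1" and "mu1 < mu2"
    and k1: "2 * (mu2 - mu1) / (hbar * lamN * (mu1 + mu2 + hbar)) > k1" "k1 > 0"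
    and k2: "min (2 / (hbar * lamN)) (4 / (lamN * (2 * mu1 + hbar))) > k2"
      "k2 > 4 / (lam2 * (mu1 + mu2))"
    and k12: "4 / (lamN * (mu1 + mu2 + hbar)) > k2 - k1" "k2 - k1 > 0"
  shows "\<exists>c>0. \<forall>h\<in>{0..hbar}. \<forall>l\<in>{lam2..lamN}. \<forall>x y.
      (x + 2 * h / (mu2 - mu1) * y
         - l * (h * (h + (mu1 + mu2)) / (2 * (mu2 - mu1))) * (k1 * x + k2 * y))\<^sup>2
      + (y - l * (h / 2) * (k1 * x + k2 * y))\<^sup>2 \<le> exp (- (c * h)) * (x\<^sup>2 + y\<^sup>2)"
proof -
  define a b where "a = mu2 - mu1" and "b = mu1 + mu2"
  have ab: "a > 0" "b > 0" "2 * mu1 = b - a" "a < b"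
    using assms(4,5) by (auto simp: a_def b_def)
  have lamN: "lamN > 0" using assms(2,3) by simp
  have k2_pos: "k2 > 0" using k1(2) k12(2) by simp
  note pos = ab(1,2,4) lamN k2_pos
  have k1': "k1 * (hbar * lamN * (b + hbar)) < 2 * a"
  proof -
    have "hbar * lamN * (b + hbar) > 0" using pos assms(1) by simp
    then show ?thesis
      using k1(1) by (simp only: pos_less_divide_eq flip: a_def b_def)
  qed
  have k2': "k2 * (hbar * lamN) < 2" "k2 * (lamN * (b - a + hbar)) < 4" "4 < k2 * (lam2 * b)"
  proof -
    have "hbar * lamN > 0" "lamN * (b - a + hbar) > 0" "lam2 * b > 0"
      using pos assms(1,2) by simp_all
    moreover have "k2 < 2 / (hbar * lamN)" "k2 < 4 / (lamN * (b - a + hbar))" "k2 > 4 / (lam2 * b)"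
      using k2 by (auto simp only: min_less_iff_conj ab(3) b_def)
    ultimately show "k2 * (hbar * lamN) < 2" "k2 * (lamN * (b - a + hbar)) < 4" "4 < k2 * (lam2 * b)"
      by (simp_all only: pos_less_divide_eq pos_divide_less_eq)
  qed
  have k12': "(k2 - k1) * (lamN * (b + hbar)) < 4"
  proof -
    have "lamN * (b + hbar) > 0" using pos assms(1) by simp
    then show ?thesis
      using k12(1) by (simp only: pos_less_divide_eq flip: b_def)
  qed
  \<comment> \<open>The smallest of the four margins, each multiplied by \<open>2 * a / h\<close>.\<close>
  define C where "C = min (min (4 - (k2 - k1) * (lamN * (b + hbar))) (a * (lam2 * (k2 - k1))))
    (min (lam2 * k1 * (b - a)) (4 - k2 * (lamN * (b - a + hbar))))"
  have "C > 0"
    using pos assms(2) k1(2) k12(2) k2'(2) k12' by (simp add: C_def)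
  have C: "C \<le> 4 - (k2 - k1) * (lamN * (b + hbar))" "C \<le> a * (lam2 * (k2 - k1))"
      "C \<le> lam2 * k1 * (b - a)" "C \<le> 4 - k2 * (lamN * (b - a + hbar))"
    by (auto simp: C_def)
  show ?thesis
  proof (intro exI[of _ "C / (2 * a)"] conjI ballI allI)
    show "C / (2 * a) > 0" using \<open>C > 0\<close> pos by simp
    fix h l x y :: real
    assume "h \<in> {0..hbar}" and "l \<in> {lam2..lamN}"
    then have h: "0 \<le> h" "h \<le> hbar" and l: "lam2 \<le> l" "l \<le> lamN" by auto
    have l0: "l > 0" using l assms(2) by linarith
    \<comment> \<open>With this unit of time the entries of the step matrix are polynomials.\<close>
    define q where "q = h / (2 * a)"
    have q: "q \<ge> 0" "2 * a * q = h" using h pos by (auto simp: q_def)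
    define m11 where "m11 = 1 - l * (q * (h + b)) * k1"
    define m12 where "m12 = 4 * q - l * (q * (h + b)) * k2"
    define m21 where "m21 = - (l * (q * a) * k1)"
    define m22 where "m22 = 1 - l * (q * a) * k2"
    define r where "r = 1 - q * C"
    have mono: "g * (l * (d + h)) \<le> g * (lamN * (d + hbar))" if "g \<ge> 0" "d \<ge> 0" for g d
      using that h l l0 by (intro mult_left_mono mult_mono) auto
    have m11: "m11 \<ge> 0"
    proof -
      have "k1 * (h * l * (b + h)) \<le> k1 * (hbar * lamN * (b + hbar))"
        using h l l0 pos k1(2) by (intro mult_left_mono mult_mono) auto
      also have "\<dots> < 2 * a" by (fact k1')
      finally have "2 * a * (l * (q * (h + b)) * k1) < 2 * a * 1"
        unfolding q(2)[symmetric] by (simp add: algebra_simps)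
      then have "l * (q * (h + b)) * k1 < 1" using pos by (simp only: mult_less_cancel_left_pos)
      then show ?thesis by (simp add: m11_def)
    qed
    have m12: "m12 \<le> 0"
    proof -
      have "k2 * (lam2 * b) \<le> k2 * (l * (b + h))"
        using h l l0 pos by (intro mult_left_mono mult_mono) auto
      then have "4 - k2 * (l * (b + h)) \<le> 0" using k2'(3) by linarith
      then have "q * (4 - k2 * (l * (b + h))) \<le> 0"
        using q(1) by (simp add: mult_nonneg_nonpos)
      then show ?thesis by (simp add: m12_def algebra_simps)
    qed
    have m21: "m21 \<le> 0" using l0 q pos k1(2) by (simp add: m21_def)
    have m22: "m22 \<ge> 0"
    proof -
      have "k2 * (h * l) \<le> k2 * (hbar * lamN)"
        using h l l0 pos by (intro mult_left_mono mult_mono) auto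
      also have "\<dots> < 2" by (fact k2'(1))
      finally have "l * (q * a) * k2 < 1"
        unfolding q(2)[symmetric] by (simp add: algebra_simps)
      then show ?thesis by (simp add: m22_def)
    qed
    have qC: "q * C \<le> q * B" if "C \<le> B" for B
      using q(1) that by (rule mult_left_mono[rotated])
    have row1: "m11 - m12 \<le> r"
    proof -
      have "C \<le> 4 - (k2 - k1) * (l * (b + h))"
        using C(1) mono[of "k2 - k1" b] k12(2) pos by linarith
      from qC[OF this] show ?thesis
        by (simp add: r_def m11_def m12_def algebra_simps)
    qed
    have row2: "m22 - m21 \<le> r"
    proof -
      have "a * (lam2 * (k2 - k1)) \<le> a * (l * (k2 - k1))"
        using l k12(2) pos by (intro mult_left_mono mult_right_mono) auto
      with C(2) have "C \<le> a * (l * (k2 - k1))" by linarith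
      from qC[OF this] show ?thesis
        by (simp add: r_def m22_def m21_def algebra_simps)
    qed
    have col1: "m11 - m21 \<le> r"
    proof -
      have "lam2 * k1 * (b - a) \<le> l * k1 * (b - a + h)"
        using l l0 k1(2) h pos by (intro mult_mono) auto
      with C(3) have "C \<le> l * k1 * (b - a + h)" by linarith
      from qC[OF this] show ?thesis
        by (simp add: r_def m11_def m21_def algebra_simps)
    qed
    have col2: "m22 - m12 \<le> r"
    proof -
      have "C \<le> 4 - k2 * (l * (b - a + h))"
        using C(4) mono[of k2 "b - a"] pos by linarith
      from qC[OF this] show ?thesis
        by (simp add: r_def m22_def m12_def algebra_simps)
    qed
    have r: "0 \<le> r" "r \<le> 1"
      using row1 m11 m12 \<open>C > 0\<close> q(1) by (linarith, simp add: r_def)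
    have "r\<^sup>2 \<le> r" using r by (simp add: power2_eq_square mult_left_le)
    also have "r \<le> exp (- (q * C))"
      using exp_ge_add_one_self[of "- (q * C)"] by (simp add: r_def)
    finally have r2: "r\<^sup>2 \<le> exp (- (q * C))" .
    have "(m11 * x + m12 * y)\<^sup>2 + (m21 * x + m22 * y)\<^sup>2 \<le> r\<^sup>2 * (x\<^sup>2 + y\<^sup>2)"
      using m11 m12 m21 m22 row1 row2 col1 col2 by (intro schur_test_2) linarith+
    also have "\<dots> \<le> exp (- (q * C)) * (x\<^sup>2 + y\<^sup>2)"
      using r2 by (intro mult_right_mono) auto
    finally have *: "(m11 * x + m12 * y)\<^sup>2 + (m21 * x + m22 * y)\<^sup>2
      \<le> exp (- (q * C)) * (x\<^sup>2 + y\<^sup>2)" .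
    have units: "2 * h / a = 4 * q" "h * (h + b) / (2 * a) = q * (h + b)" "h / 2 = q * a"
        "C / (2 * a) * h = q * C"
      using pos by (simp_all add: q_def)
    have "m11 * x + m12 * y = x + 4 * q * y - l * (q * (h + b)) * (k1 * x + k2 * y)"
        "m21 * x + m22 * y = y - l * (q * a) * (k1 * x + k2 * y)"
      by (simp_all add: m11_def m12_def m21_def m22_def algebra_simps)
    with * show "(x + 2 * h / (mu2 - mu1) * y
         - l * (h * (h + (mu1 + mu2)) / (2 * (mu2 - mu1))) * (k1 * x + k2 * y))\<^sup>2
      + (y - l * (h / 2) * (k1 * x + k2 * y))\<^sup>2 \<le> exp (- (C / (2 * a) * h)) * (x\<^sup>2 + y\<^sup>2)"
      by (simp only: units flip: a_def b_def)
  qed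
qed

section \<open>The Laplacian of a balanced graph\<close>

lemma laplacian_mult_nth:
  "(laplacian W *v y) $ i = (\<Sum>j\<in>UNIV. W $ i $ j * (y $ i - y $ j))"
proof -
  have "(laplacian W *v y) $ i
      = (\<Sum>j\<in>UNIV. (if i = j then in_degree W i else 0) * y $ j - W $ i $ j * y $ j)"
    by (simp add: laplacian_def matrix_vector_mult_def left_diff_distrib)
  also have "\<dots> = in_degree W i * y $ i - (\<Sum>j\<in>UNIV. W $ i $ j * y $ j)"
    by (simp add: sum_subtractf if_distrib[of "\<lambda>c. c * _"] cong: if_cong)
  finally show ?thesis
    by (simp add: in_degree_def sum_distrib_right right_diff_distrib sum_subtractf)
qed

lemma balanced_nth: "balanced W \<Longrightarrow> W $ i $ j = W $ j $ i"
  unfolding balanced_def by (subst (asm) vec_eq_iff) (simp add: vec_eq_iff transpose_def)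

lemma laplacian_symmetric:
  assumes "balanced W"
  shows "(laplacian W *v v) \<bullet> w = v \<bullet> (laplacian W *v w)"
proof -
  have "transpose (laplacian W) = laplacian W"
    using balanced_nth[OF assms] by (simp add: laplacian_def transpose_def vec_eq_iff)
  then show ?thesis
    by (metis dot_lmul_matrix vector_transpose_matrix)
qed

text \<open>Grouping the two orientations of an edge makes the quadratic form of the Laplacian a weighted
  sum of squared differences along edges. With nonnegative weights it vanishes only for vectors that
  are constant along every edge.\<close>

lemma laplacian_energy:
  assumes "balanced W"
  shows "2 * (y \<bullet> (laplacian W *v y)) = (\<Sum>i\<in>UNIV. \<Sum>j\<in>UNIV. W $ i $ j * (y $ i - y $ j)\<^sup>2)"
proof -
  have "y \<bullet> (laplacian W *v y) = (\<Sum>i\<in>UNIV. \<Sum>j\<in>UNIV. W $ i $ j * (y $ i * (y $ i - y $ j)))"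
    by (simp add: inner_vec_def laplacian_mult_nth sum_distrib_left mult.left_commute)
  moreover have "y \<bullet> (laplacian W *v y)
      = (\<Sum>i\<in>UNIV. \<Sum>j\<in>UNIV. W $ i $ j * (y $ j * (y $ j - y $ i)))"
    unfolding calculation by (subst sum.swap) (simp add: balanced_nth[OF assms])
  ultimately have "2 * (y \<bullet> (laplacian W *v y))
      = (\<Sum>i\<in>UNIV. \<Sum>j\<in>UNIV. W $ i $ j * (y $ i * (y $ i - y $ j)) + W $ i $ j * (y $ j * (y $ j - y $ i)))"
    by (simp only: sum.distrib mult_2)
  then show ?thesis
    by (simp add: power2_eq_square algebra_simps)
qed

lemma laplacian_kernel:
  assumes "weighted_graph E W" "balanced W" "has_spanning_tree E" "laplacian W *v y = 0"
  shows "y $ i = y $ j"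
proof -
  have nonneg: "W $ i $ j * (y $ i - y $ j)\<^sup>2 \<ge> 0" for i j
    using assms(1) by (cases "(i, j) \<in> E") (auto simp: weighted_graph_def intro!: mult_nonneg_nonneg intro: less_imp_le)
  have "(\<Sum>i\<in>UNIV. \<Sum>j\<in>UNIV. W $ i $ j * (y $ i - y $ j)\<^sup>2) = 0"
    using laplacian_energy[OF assms(2), of y] assms(4) by simp
  then have zero: "W $ i $ j * (y $ i - y $ j)\<^sup>2 = 0" for i j
    by (simp add: sum_nonneg_eq_0_iff nonneg sum_nonneg)
  have edge: "y $ i = y $ j" if "(i, j) \<in> E" for i j
  proof -
    have "W $ i $ j > 0" using assms(1) that by (simp add: weighted_graph_def)
    then show ?thesis using zero[of i j] by simp
  qed
  obtain F r where F: "F \<subseteq> E" "\<And>i. (i, r) \<in> F\<^sup>*"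
    using assms(3) by (auto simp: has_spanning_tree_def directed_tree_def)
  have "y $ i = y $ r" for i
    using F(2)[of i] by (induction rule: converse_rtrancl_induct) (use F(1) edge in force)+
  then show ?thesis by metis
qed

section \<open>One sampling interval\<close>

text \<open>The orthogonal projection onto the complement of the all-ones vector, that is, the deviation
  from the average. It measures disagreement, and it is the same projection for every graph.\<close>

definition centred :: "real^'n \<Rightarrow> real^'n::finite" where
  "centred y = (\<chi> i. y $ i - (\<Sum>j\<in>UNIV. y $ j) / real CARD('n))"

lemma centred_add: "centred (x + y) = centred x + centred y"
  by (simp add: centred_def vec_eq_iff sum.distrib add_divide_distrib)

lemma centred_scaleR: "centred (c *\<^sub>R x) = c *\<^sub>R centred x"
  by (simp add: centred_def vec_eq_iff right_diff_distrib flip: sum_distrib_left)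

lemma centred_diff: "centred (x - y) = centred x - centred y"
  by (simp add: centred_def vec_eq_iff sum_subtractf diff_divide_distrib)

lemma centred_nth_diff: "centred y $ i - centred y $ j = y $ i - y $ j"
  by (simp add: centred_def)

lemma sum_centred: "(\<Sum>i\<in>UNIV. centred y $ i) = 0"
  by (simp add: centred_def sum_subtractf)

lemma laplacian_centred: "laplacian W *v centred y = laplacian W *v y"
  by (simp add: vec_eq_iff laplacian_mult_nth centred_nth_diff)

lemma sum_laplacian:
  assumes "balanced W"
  shows "(\<Sum>i\<in>UNIV. (laplacian W *v y) $ i) = 0"
proof -
  have "laplacian W *v 1 = 0"
    by (simp add: vec_eq_iff laplacian_mult_nth)
  then have "1 \<bullet> (laplacian W *v y) = 0"
    by (metis laplacian_symmetric[OF assms] inner_zero_left)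
  then show ?thesis
    by (simp add: inner_vec_def)
qed

lemma centred_laplacian:
  "balanced W \<Longrightarrow> centred (laplacian W *v y) = laplacian W *v y"
  by (simp add: centred_def sum_laplacian vec_eq_iff)

text \<open>
  The input enters both coordinate vectors through the Laplacian, so an orthonormal eigenbasis of the
  Laplacian on the sum-zero subspace splits the step into planar steps, one for each eigenvalue.
  Connectivity excludes the eigenvalue zero there. Since the sum of squared norms does not depend on
  the eigenbasis, the planar bounds add up to a bound that makes no reference to the basis and can be
  iterated although the graphs, and with them the eigenbases, change.
\<close>

lemma disagreement_step:
  fixes W :: "real^'n^'n::finite"
  assumes graph: "weighted_graph E W" "balanced W" "has_spanning_tree E"
    and spectrum: "\<And>c. eigenvalue (laplacian W) c \<Longrightarrow> c \<noteq> 0 \<Longrightarrow> c \<in> I"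
    and modes: "\<And>l x y. l \<in> I \<Longrightarrow> (x + g * y - l * p1 * (k1 * x + k2 * y))\<^sup>2
      + (y - l * p2 * (k1 * x + k2 * y))\<^sup>2 \<le> r * (x\<^sup>2 + y\<^sup>2)"
  defines "u \<equiv> \<lambda>z1 z2. laplacian W *v (k1 *\<^sub>R z1 + k2 *\<^sub>R z2)"
  shows "(norm (centred (z1 + g *\<^sub>R z2 - p1 *\<^sub>R u z1 z2)))\<^sup>2 + (norm (centred (z2 - p2 *\<^sub>R u z1 z2)))\<^sup>2
    \<le> r * ((norm (centred z1))\<^sup>2 + (norm (centred z2))\<^sup>2)"
proof -
  define S :: "(real^'n) set" where "S = {y. (\<Sum>i\<in>UNIV. y $ i) = 0}"
  have "subspace S"
    by (auto simp: S_def subspace_def sum.distrib simp flip: sum_distrib_left)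
  moreover have "((*v) (laplacian W)) ` S \<subseteq> S"
    using sum_laplacian[OF graph(2)] by (auto simp: S_def)
  ultimately obtain B where B: "finite B" "B \<subseteq> S" "pairwise orthogonal B" "\<And>e. e \<in> B \<Longrightarrow> norm e = 1"
      "S \<subseteq> span B" "\<forall>e\<in>B. \<exists>c. laplacian W *v e = c *\<^sub>R e"
    using symmetric_orthonormal_eigenbasis[of "(*v) (laplacian W)" S]
      laplacian_symmetric[OF graph(2)] by auto
  have centred_S: "centred y \<in> S" for y by (simp add: S_def sum_centred)
  have parseval: "(norm (centred y))\<^sup>2 = (\<Sum>e\<in>B. (centred y \<bullet> e)\<^sup>2)" for y
    using B centred_S by (intro parseval_orthonormal) auto
  have mode: "(centred (z1 + g *\<^sub>R z2 - p1 *\<^sub>R u z1 z2) \<bullet> e)\<^sup>2 + (centred (z2 - p2 *\<^sub>R u z1 z2) \<bullet> e)\<^sup>2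
      \<le> r * ((centred z1 \<bullet> e)\<^sup>2 + (centred z2 \<bullet> e)\<^sup>2)" if eB: "e \<in> B" for e
  proof -
    obtain l where l: "laplacian W *v e = l *\<^sub>R e" using B(6) eB by blast
    have "norm e = 1" using eB by (rule B(4))
    then have e: "e \<noteq> 0" "e \<in> S" using B(2) eB by auto
    have "l \<noteq> 0"
    proof
      assume "l = 0"
      then have const: "e $ i = e $ j" for i j
        using laplacian_kernel[OF graph] l by simp
      have "e $ i = 0" for i
      proof -
        have "(\<Sum>j\<in>UNIV. e $ j) = (\<Sum>j\<in>(UNIV :: 'n set). e $ i)"
          using const by (intro sum.cong) auto
        then show ?thesis using e(2) by (simp add: S_def)
      qed
      then show False using e(1) by (simp add: vec_eq_iff)
    qed
    then have lI: "l \<in> I"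
      using spectrum[of l] e(1) l by (auto simp: eigenvalue_def)
    have u: "centred (u z1 z2) \<bullet> e = l * (k1 * (centred z1 \<bullet> e) + k2 * (centred z2 \<bullet> e))"
    proof -
      have "centred (u z1 z2) = laplacian W *v (centred (k1 *\<^sub>R z1 + k2 *\<^sub>R z2))"
        using graph(2) by (simp add: u_def centred_laplacian laplacian_centred)
      then show ?thesis
        by (simp add: laplacian_symmetric[OF graph(2)] l centred_add centred_scaleR inner_add_left)
    qed
    show ?thesis
      using modes[OF lI, of "centred z1 \<bullet> e" "centred z2 \<bullet> e"]
      by (simp add: centred_add centred_diff centred_scaleR inner_add_left inner_diff_left u mult_ac)
  qed
  show ?thesis
    unfolding parseval by (simp only: sum_distrib_left mode sum_mono flip: sum.distrib)
qed

section \<open>Trajectories of the sampled-data system\<close>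

text \<open>The differential equation holds only on the half-open interval; continuity of the state
  carries the formulas over to its right end, where the next interval starts.\<close>

lemma agent_trajectory_between_samples:
  assumes x: "agent_trajectory t u x" and t: "0 \<le> t k" "t k < t (Suc k)"
    and u: "\<And>s. s \<in> {t k..<t (Suc k)} \<Longrightarrow> u s = u0"
    and s: "s \<in> {t k..t (Suc k)}"
  shows "x s $ 2 = x (t k) $ 2 + (s - t k) * u0"
    and "x s $ 1 = x (t k) $ 1 + (s - t k) * x (t k) $ 2 + (s - t k)\<^sup>2 / 2 * u0"
proof -
  have cont: "continuous_on {t k..t (Suc k)} (\<lambda>s. x s $ i)" for i
    using x t by (intro continuous_intros) (auto simp: agent_trajectory_def elim: continuous_on_subset)
  have deriv: "((\<lambda>s. x s $ i) has_real_derivative (A_mat *v x s + u0 *\<^sub>R B_vec) $ i) (at s)"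
    if "t k < s" "s < t (Suc k)" for s i
  proof -
    have "(x has_vector_derivative (A_mat *v x s + u s *\<^sub>R B_vec)) (at s within {t k..<t (Suc k)})"
      using x that by (simp add: agent_trajectory_def)
    then have "(x has_vector_derivative (A_mat *v x s + u0 *\<^sub>R B_vec)) (at s)"
      using that u[of s] at_within_interior[of s "{t k..<t (Suc k)}"] by simp
    then show ?thesis
      unfolding has_real_derivative_iff_has_vector_derivative
      by (rule bounded_linear.has_vector_derivative[OF bounded_linear_vec_nth])
  qed
  have AB: "(A_mat *v y + u0 *\<^sub>R B_vec) $ 1 = y $ 2" "(A_mat *v y + u0 *\<^sub>R B_vec) $ 2 = u0" for y
    by (simp_all add: A_mat_def B_vec_def matrix_vector_mult_def sum_2)
  note deriv1 = deriv[where i = 1, unfolded AB] and deriv2 = deriv[where i = 2, unfolded AB]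
  \<comment> \<open>Each candidate solution differs from the state by a function with zero derivative.\<close>
  have v: "x s $ 2 = x (t k) $ 2 + (s - t k) * u0" if "s \<in> {t k..t (Suc k)}" for s
  proof -
    have "x s $ 2 - (s - t k) * u0 = x (t k) $ 2 - (t k - t k) * u0"
    proof (rule DERIV_isconst2[OF t(2), where f = "\<lambda>s. x s $ 2 - (s - t k) * u0"])
      show "continuous_on {t k..t (Suc k)} (\<lambda>s. x s $ 2 - (s - t k) * u0)"
        by (intro continuous_intros cont)
      show "((\<lambda>s. x s $ 2 - (s - t k) * u0) has_real_derivative 0) (at s)"
        if "t k < s" "s < t (Suc k)" for s
        by (rule derivative_eq_intros deriv2[OF that] refl)+ simp
    qed (use that in auto)
    then show ?thesis by simp
  qed
  then show "x s $ 2 = x (t k) $ 2 + (s - t k) * u0" using s .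
  have "x s $ 1 - (s - t k) * x (t k) $ 2 - (s - t k)\<^sup>2 / 2 * u0
      = x (t k) $ 1 - (t k - t k) * x (t k) $ 2 - (t k - t k)\<^sup>2 / 2 * u0"
  proof (rule DERIV_isconst2[OF t(2),
        where f = "\<lambda>s. x s $ 1 - (s - t k) * x (t k) $ 2 - (s - t k)\<^sup>2 / 2 * u0"])
    show "continuous_on {t k..t (Suc k)}
        (\<lambda>s. x s $ 1 - (s - t k) * x (t k) $ 2 - (s - t k)\<^sup>2 / 2 * u0)"
      by (intro continuous_intros cont) auto
    show "((\<lambda>s. x s $ 1 - (s - t k) * x (t k) $ 2 - (s - t k)\<^sup>2 / 2 * u0)
        has_real_derivative 0) (at s)" if "t k < s" "s < t (Suc k)" for s
    proof -
      have "((\<lambda>s. (s - t k) * x (t k) $ 2) has_real_derivative x (t k) $ 2) (at s)"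
          "((\<lambda>s. (s - t k)\<^sup>2 / 2 * u0) has_real_derivative (s - t k) * u0) (at s)"
        by (auto intro!: derivative_eq_intros)
      from DERIV_diff[OF DERIV_diff[OF deriv1[OF that] this(1)] this(2)]
      show ?thesis using v[of s] that by simp
    qed
  qed (use s in auto)
  then show "x s $ 1 = x (t k) $ 1 + (s - t k) * x (t k) $ 2 + (s - t k)\<^sup>2 / 2 * u0" by simp
qed

lemma feedback_gain_in_transformed_coordinates:
  fixes a b k1 k2 :: real
  assumes "a \<noteq> 0" and K: "K = vector [k1, k2] v* matrix_inv (vector [vector [a, - b], vector [0, 2]] :: real^2^2)"
  shows "K \<bullet> x = k1 * ((x $ 1 + b / 2 * x $ 2) / a) + k2 * (x $ 2 / 2)"
proof -
  let ?T = "vector [vector [a, - b], vector [0, 2]] :: real^2^2"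
  have "invertible ?T"
    using assms(1) by (simp add: invertible_det_nz det_2)
  then have inv: "?T ** matrix_inv ?T = mat 1 \<and> matrix_inv ?T ** ?T = mat 1"
    unfolding invertible_def matrix_inv_def by (rule someI_ex)
  define z :: "real^2" where "z = vector [(x $ 1 + b / 2 * x $ 2) / a, x $ 2 / 2]"
  have "?T *v z = x"
    using assms(1) by (simp add: z_def vec_eq_iff forall_2 matrix_vector_mult_def sum_2 field_simps)
  moreover have "matrix_inv ?T *v (?T *v z) = z"
    using inv by (simp add: matrix_vector_mul_assoc)
  ultimately have "K \<bullet> x = vector [k1, k2] \<bullet> z"
    by (simp add: K dot_lmul_matrix)
  then show ?thesis by (simp add: z_def inner_vec_def sum_2)
qed

text \<open>The decay rate is proportional to the length of the interval, so the factors multiply to an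
  exponential of the elapsed time. Thus arbitrarily short sampling intervals do no harm, although the
  factor of a single interval then comes arbitrarily close to one.\<close>

lemma admissible_sampling_exponential_decay:
  fixes V :: "real \<Rightarrow> real"
  assumes "admissible_sampling hbar t"
    and step: "\<And>k s. s \<in> {t k..t (Suc k)} \<Longrightarrow> V s \<le> exp (- (c * (s - t k))) * V (t k)"
    and "s \<ge> 0"
  shows "V s \<le> exp (- (c * s)) * V 0"
proof -
  have t: "t 0 = 0" "filterlim t at_top sequentially" "\<And>k. t k < t (Suc k)"
    using assms(1) by (auto simp: admissible_sampling_def)
  have compose: "V s \<le> exp (- (c * s)) * V 0"
    if "s \<in> {t k..t (Suc k)}" "V (t k) \<le> exp (- (c * t k)) * V 0" for k s
  proof -
    have "V s \<le> exp (- (c * (s - t k))) * (exp (- (c * t k)) * V 0)"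
      by (rule order_trans[OF step[OF that(1)]]) (intro mult_left_mono that(2) exp_ge_zero)
    also have "\<dots> = exp (- (c * s)) * V 0"
      by (simp add: mult.assoc[symmetric] exp_add[symmetric] right_diff_distrib)
    finally show ?thesis .
  qed
  have samples: "V (t k) \<le> exp (- (c * t k)) * V 0" for k
  proof (induction k)
    case (Suc k)
    then show ?case using t(3)[of k] by (intro compose[OF _ Suc]) auto
  qed (simp add: t(1))
  have ex: "\<exists>n. s < t n"
    using t(2) unfolding filterlim_at_top_dense by (blast dest: eventually_happens'[OF sequentially_bot])
  define n where "n = (LEAST n. s < t n)"
  have n: "s < t n" unfolding n_def using ex by (rule LeastI_ex)
  then obtain k where k: "n = Suc k" using t(1) assms(3) by (cases n) auto
  have "\<not> s < t k" using k unfolding n_def by (metis lessI not_less_Least)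
  with n k show ?thesis by (intro compose[OF _ samples[of k]]) auto
qed

section \<open>Consensus\<close>

theorem mainTheorem3:
  fixes hbar lam2 lamN mu1 mu2 k1 k2 :: real
    and T :: "real^2^2" and K :: "real^2"
    and t :: "nat \<Rightarrow> real"
    and E :: "nat \<Rightarrow> ('n::finite \<times> 'n) set" and W :: "nat \<Rightarrow> real^'n^'n"
  assumes "hbar > 0" and "0 < lam2" and "lam2 \<le> lamN" and "0 < mu1" and "mu1 < mu2"
    and T: "T = vector [vector [mu2 - mu1, - (mu2 + mu1)], vector [0, 2]]"
    and k1: "2 * (mu2 - mu1) / (hbar * lamN * (mu1 + mu2 + hbar)) > k1" "k1 > 0"
    and k2: "min (2 / (hbar * lamN)) (4 / (lamN * (2 * mu1 + hbar))) > k2"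
      "k2 > 4 / (lam2 * (mu1 + mu2))"
    and k12: "4 / (lamN * (mu1 + mu2 + hbar)) > k2 - k1" "k2 - k1 > 0"
    and K: "K = vector [k1, k2] v* matrix_inv T"
    and sampling: "admissible_sampling hbar t"
    and graph: "\<And>k. weighted_graph (E k) (W k)" "\<And>k. balanced (W k)"
      "\<And>k. has_spanning_tree (E k)"
    and spectrum: "\<And>k c. eigenvalue (laplacian (W k)) c \<Longrightarrow> c \<noteq> 0 \<Longrightarrow> c \<in> {lam2..lamN}"
  shows "solves_consensus t (sampled_control_law t K W)"
  unfolding solves_consensus_def
proof (intro allI impI, elim conjE)
  fix x0 :: "'n \<Rightarrow> real^2" and x u and i j :: 'n
  assume x: "\<forall>i. agent_trajectory t (u i) (x i)" and law: "sampled_control_law t K W x u"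
  define a b where "a = mu2 - mu1" and "b = mu1 + mu2"
  have a: "a > 0" using assms(5) by (simp add: a_def)
  obtain c where c: "c > 0"
    and modes: "\<forall>h\<in>{0..hbar}. \<forall>l\<in>{lam2..lamN}. \<forall>x y.
      (x + 2 * h / a * y - l * (h * (h + b) / (2 * a)) * (k1 * x + k2 * y))\<^sup>2
      + (y - l * (h / 2) * (k1 * x + k2 * y))\<^sup>2 \<le> exp (- (c * h)) * (x\<^sup>2 + y\<^sup>2)"
    using mode_contraction[OF assms(1-5) k1 k2 k12, folded a_def b_def] by (elim exE conjE)
  \<comment> \<open>The two components of the agent states in the coordinates given by \<open>T\<close>, collected over all agents.\<close>
  define z1 z2 :: "real \<Rightarrow> real^'n"
    where "z1 = (\<lambda>s. \<chi> i. (x i s $ 1 + b / 2 * x i s $ 2) / a)" and "z2 = (\<lambda>s. \<chi> i. x i s $ 2 / 2)"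
  define V where "V = (\<lambda>s. (norm (centred (z1 s)))\<^sup>2 + (norm (centred (z2 s)))\<^sup>2)"
  have t: "t k < t (Suc k)" "t (Suc k) - t k \<le> hbar" for k
    using sampling by (auto simp: admissible_sampling_def less_imp_le)
  have t0: "0 \<le> t k" for k
  proof (induction k)
    case 0
    then show ?case using sampling by (simp add: admissible_sampling_def)
  next
    case (Suc k)
    then show ?case using t(1)[of k] by linarith
  qed
  \<comment> \<open>The bound for a whole sampling interval holds for every shorter one, hence also between the
    sampling instants.\<close>
  have step: "V s \<le> exp (- (c * (s - t k))) * V (t k)" if s: "s \<in> {t k..t (Suc k)}" for k s
  proof -
    define h where "h = s - t k"
    define U where "U = laplacian (W k) *v (k1 *\<^sub>R z1 (t k) + k2 *\<^sub>R z2 (t k))"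
    have Kx: "K \<bullet> x i (t k) = (k1 *\<^sub>R z1 (t k) + k2 *\<^sub>R z2 (t k)) $ i" for i
      unfolding z1_def z2_def
      using feedback_gain_in_transformed_coordinates[of a K k1 k2 b "x i (t k)"] a K
      by (simp add: T a_def b_def add.commute)
    have input: "u i r = - U $ i" if "r \<in> {t k..<t (Suc k)}" for i r
    proof -
      have "u i r = (\<Sum>j\<in>UNIV. W k $ i $ j * (K \<bullet> x j (t k) - K \<bullet> x i (t k)))"
        using law that by (simp add: sampled_control_law_def inner_sum_right inner_diff_right)
      also have "\<dots> = - U $ i"
        unfolding U_def laplacian_mult_nth Kx sum_negf[symmetric]
        by (intro sum.cong) (simp_all add: algebra_simps)
      finally show ?thesis .
    qed
    have flow: "x i s $ 2 = x i (t k) $ 2 - h * U $ i"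
        "x i s $ 1 = x i (t k) $ 1 + h * x i (t k) $ 2 - h\<^sup>2 / 2 * U $ i" for i
      using agent_trajectory_between_samples[OF x[rule_format, of i] t0 t(1) input s]
      by (simp_all add: h_def)
    have "z1 s = z1 (t k) + (2 * h / a) *\<^sub>R z2 (t k) - (h * (h + b) / (2 * a)) *\<^sub>R U"
      using a by (simp add: vec_eq_iff z1_def z2_def flow field_simps power2_eq_square)
    moreover have "z2 s = z2 (t k) - (h / 2) *\<^sub>R U"
      by (simp add: vec_eq_iff z2_def flow field_simps)
    moreover have "h \<in> {0..hbar}" using s t(2)[of k] by (auto simp: h_def)
    then have "(norm (centred (z1 (t k) + (2 * h / a) *\<^sub>R z2 (t k) - (h * (h + b) / (2 * a)) *\<^sub>R U)))\<^sup>2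
        + (norm (centred (z2 (t k) - (h / 2) *\<^sub>R U)))\<^sup>2 \<le> exp (- (c * h)) * V (t k)"
      unfolding V_def U_def
      by (intro disagreement_step[where I = "{lam2..lamN}", OF graph spectrum]) (use modes in blast)+
    ultimately show ?thesis by (simp only: V_def h_def)
  qed
  have decay: "V s \<le> exp (- (c * s)) * V 0" if "s \<ge> 0" for s
    using sampling step that by (rule admissible_sampling_exponential_decay)
  have "((\<lambda>s. exp (- (c * s)) * V 0) \<longlongrightarrow> 0 * V 0) at_top"
    by (intro tendsto_intros filterlim_compose[OF exp_at_bot] filterlim_uminus_at_bot_at_top[THEN filterlim_compose]
        filterlim_tendsto_pos_mult_at_top[OF tendsto_const c] filterlim_ident)
  then have limit: "((\<lambda>s. exp (- (c * s)) * V 0) \<longlongrightarrow> 0) at_top" by simp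
  have V0: "(V \<longlongrightarrow> 0) at_top"
  proof (rule tendsto_sandwich[OF _ _ tendsto_const limit])
    show "\<forall>\<^sub>F s in at_top. 0 \<le> V s" by (simp add: V_def)
    show "\<forall>\<^sub>F s in at_top. V s \<le> exp (- (c * s)) * V 0"
      using eventually_ge_at_top[of 0] by eventually_elim (rule decay)
  qed
  have vanish: "((\<lambda>s. z s $ i - z s $ j) \<longlongrightarrow> 0) at_top"
    if "\<And>s. (norm (centred (z s)))\<^sup>2 \<le> V s" for z :: "real \<Rightarrow> real^'n"
  proof -
    have "((\<lambda>s. (norm (centred (z s)))\<^sup>2) \<longlongrightarrow> 0) at_top"
      by (rule tendsto_sandwich[OF _ _ tendsto_const V0]) (use that in auto)
    then have "((\<lambda>s. sqrt ((norm (centred (z s)))\<^sup>2)) \<longlongrightarrow> sqrt 0) at_top"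
      by (rule tendsto_real_sqrt)
    then have "((\<lambda>s. centred (z s)) \<longlongrightarrow> 0) at_top"
      by (simp add: tendsto_norm_zero_iff)
    then have "((\<lambda>s. centred (z s) $ i - centred (z s) $ j) \<longlongrightarrow> 0 $ i - 0 $ j) at_top"
      by (intro tendsto_intros)
    then show ?thesis by (simp add: centred_nth_diff)
  qed
  have z: "((\<lambda>s. z1 s $ i - z1 s $ j) \<longlongrightarrow> 0) at_top" "((\<lambda>s. z2 s $ i - z2 s $ j) \<longlongrightarrow> 0) at_top"
    by (rule vanish, simp add: V_def)+
  have "((\<lambda>s. (x i s - x j s) $ 1) \<longlongrightarrow> a * 0 - b * 0) at_top"
    by (rule Lim_transform_eventually[OF tendsto_diff[OF tendsto_mult_left[OF z(1)] tendsto_mult_left[OF z(2)]]])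
       (use a in \<open>simp add: z1_def z2_def field_simps\<close>)
  moreover have "((\<lambda>s. (x i s - x j s) $ 2) \<longlongrightarrow> 2 * 0) at_top"
    by (rule Lim_transform_eventually[OF tendsto_mult_left[OF z(2)]])
       (simp add: z2_def field_simps)
  ultimately have "\<forall>m. ((\<lambda>s. (x i s - x j s) $ m) \<longlongrightarrow> 0 $ m) at_top"
    by (simp add: forall_2)
  then show "((\<lambda>s. x i s - x j s) \<longlongrightarrow> 0) at_top"
    by (blast intro: vec_tendstoI)
qed

end
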